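(* Let $a,b>0$ and $0\leq t\leq 1$. Then $$\frac{a!_t b+a!_{1-t}b}{2}+4t(1-t)\,(a\nabla b-a!b)\leq a\nabla b.$$
   Context: For $a,b>0$ and $0\le t\le 1$: the weighted harmonic mean is $a!_t b=((1-t)a^{-1}+tb^{-1})^{-1}$, with $a!b=a!_{1/2}b$; the weighted arithmetic mean is $a\nabla_t b=(1-t)a+tb$, with $a\nabla b=a\nabla_{1/2}b=\frac{a+b}{2}$. *)

theory Defs
  imports Complex_Main
begin

definition wharm :: "real \<Rightarrow> real \<Rightarrow> real \<Rightarrow> real" where
  "wharm t a b = inverse ((1 - t) * inverse a + t * inverse b)"

definition warith :: "real \<Rightarrow> real \<Rightarrow> real \<Rightarrow> real" where
  "warith t a b = (1 - t) * a + t * b"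

abbreviation harm_mean :: "real \<Rightarrow> real \<Rightarrow> real" where
  "harm_mean a b \<equiv> wharm (1/2) a b"

abbreviation arith_mean :: "real \<Rightarrow> real \<Rightarrow> real" where
  "arith_mean a b \<equiv> warith (1/2) a b"

end

theory Submission
  imports Defs
begin

text \<open>
  The inequality reduces to \<open>G + s * D \<le> G + D\<close>, where \<open>G = a * b\<close>,
  \<open>D = ((a - b) / 2)\<^sup>2\<close>, and \<open>s = 4 * t * (1 - t)\<close> lies in \<open>[0, 1]\<close>.
  Write \<open>A\<close> for the arithmetic mean, so that \<open>A\<^sup>2 = G + D\<close>. A weighted harmonic mean is \<open>G\<close>
  divided by a weighted arithmetic mean; the arithmetic means with weights \<open>t\<close> and \<open>1 - t\<close> have
  sum \<open>2 * A\<close> and product \<open>G + s * D\<close>. Hence the two harmonic means average to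
  \<open>G * A / (G + s * D)\<close> (lemma \<open>average_wharm\<close>), which falls short of \<open>A\<close> by
  \<open>s * D * A / (G + s * D)\<close>. On the other hand \<open>A\<close> exceeds the unweighted harmonic mean by \<open>D / A\<close>
  (lemma \<open>arith_mean_minus_harm_mean\<close>). So the claim is
  \<open>s * D / A \<le> s * D * A / (G + s * D)\<close>, which follows from
  \<open>G + s * D \<le> A\<^sup>2\<close>.
\<close>

lemma wharm_eq_divide_warith:
  assumes "a \<noteq> 0" and "b \<noteq> 0"
  shows "wharm t a b = a * b / warith t b a"
proof -
  have "(1 - t) * inverse a + t * inverse b = warith t b a / (a * b)"
    using assms by (simp add: warith_def field_simps)
  then show ?thesis
    by (simp add: wharm_def)
qed

lemma warith_pos:
  assumes "a > 0" and "b > 0" and "0 \<le> t" and "t \<le> 1"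
  shows "warith t a b > 0"
proof (cases "t = 0")
  case True
  then show ?thesis using assms by (simp add: warith_def)
next
  case False
  then show ?thesis
    using assms unfolding warith_def by (intro add_nonneg_pos) auto
qed

lemma warith_mult_complement:
  "warith t b a * warith (1 - t) b a = a * b + 4 * t * (1 - t) * ((a - b) / 2)\<^sup>2"
  by (simp add: warith_def power2_eq_square field_simps)

lemma average_wharm:
  assumes "a > 0" and "b > 0" and "0 \<le> t" and "t \<le> 1"
  shows "(wharm t a b + wharm (1 - t) a b) / 2
           = a * b * arith_mean a b / (a * b + 4 * t * (1 - t) * ((a - b) / 2)\<^sup>2)"
proof -
  let ?P = "warith t b a" and ?Q = "warith (1 - t) b a"
  have pos: "?P > 0" "?Q > 0"
    using assms by (auto intro: warith_pos)
  have sum: "?P + ?Q = 2 * arith_mean a b"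
    by (simp add: warith_def field_simps)
  have "(wharm t a b + wharm (1 - t) a b) / 2 = (a * b / ?P + a * b / ?Q) / 2"
    using assms by (simp add: wharm_eq_divide_warith)
  also have "\<dots> = a * b * ((?P + ?Q) / 2) / (?P * ?Q)"
    using pos by (simp add: field_simps)
  also have "(?P + ?Q) / 2 = arith_mean a b"
    unfolding sum by simp
  finally show ?thesis
    unfolding warith_mult_complement .
qed

lemma arith_mean_power2: "(arith_mean a b)\<^sup>2 = a * b + ((a - b) / 2)\<^sup>2"
  by (simp add: warith_def power2_eq_square field_simps)

lemma arith_mean_minus_harm_mean:
  assumes "a > 0" and "b > 0"
  shows "arith_mean a b - harm_mean a b = ((a - b) / 2)\<^sup>2 / arith_mean a b"
proof -
  have pos: "arith_mean a b > 0"
    using assms by (simp add: warith_pos)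
  have "harm_mean a b = a * b / arith_mean a b"
    using assms by (simp add: wharm_eq_divide_warith) (simp add: warith_def add.commute)
  then have "arith_mean a b - harm_mean a b = ((arith_mean a b)\<^sup>2 - a * b) / arith_mean a b"
    using pos by (simp add: field_simps power2_eq_square)
  then show ?thesis
    by (simp add: arith_mean_power2)
qed

lemma four_mult_complement_le_1: "4 * t * (1 - t) \<le> (1::real)"
proof -
  have "1 - 4 * t * (1 - t) = (1 - 2 * t)\<^sup>2"
    by (simp add: power2_eq_square algebra_simps)
  then show ?thesis
    by (metis diff_ge_0_iff_ge zero_le_power2)
qed

theorem corollary2p2:
  fixes a b t :: real
  assumes "a > 0" and "b > 0" and "0 \<le> t" and "t \<le> 1"
  shows "(wharm t a b + wharm (1 - t) a b) / 2
           + 4 * t * (1 - t) * (arith_mean a b - harm_mean a b) \<le> arith_mean a b"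
proof -
  define A G D s where "A = arith_mean a b" and "G = a * b"
    and "D = ((a - b) / 2)\<^sup>2" and "s = 4 * t * (1 - t)"
  have A: "A > 0" and G: "G > 0" and D: "D \<ge> 0" and s: "0 \<le> s" "s \<le> 1"
    using assms four_mult_complement_le_1[of t]
    by (simp_all add: A_def G_def D_def s_def warith_pos)
  have sD: "s * D \<ge> 0"
    using s D by simp
  then have den: "G + s * D > 0"
    using G by simp
  have "G + s * D \<le> G + D"
    using s D by (simp add: mult_left_le_one_le)
  then have "G + s * D \<le> A * A"
    using arith_mean_power2[of a b] by (simp add: A_def G_def D_def power2_eq_square)
  then have "s * D * (G + s * D) \<le> s * D * (A * A)"
    using sD by (rule mult_left_mono)
  then have "s * D / A \<le> s * D * A / (G + s * D)"
    using A den by (simp add: divide_le_eq pos_le_divide_eq mult.assoc mult.commute)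
  also have "\<dots> = A - G * A / (G + s * D)"
    using den by (simp add: field_simps)
  finally have "G * A / (G + s * D) + s * (D / A) \<le> A"
    by simp
  then show ?thesis
    unfolding average_wharm[OF assms] arith_mean_minus_harm_mean[OF assms(1,2)]
    by (simp only: A_def G_def D_def s_def)
qed

end
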